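(* Let $U\subset\mathbb{R}^n$ be a smooth bounded domain and let $0<s<1$. Let $\Lambda^D_{s,\infty}=\lim_{p\to+\infty}(\lambda^D_{s,p})^{1/p}$, where $\lambda^D_{s,p}$ is the first Dirichlet eigenvalue of the fractional $p$-Laplacian of order $s$ in $U$. Then $$\frac{1}{\Lambda^D_{s,\infty}}=\sup_{\mu\in P(\overline U)} W_s(\mu,P(\partial U)),$$ where $$W_s(\mu,\nu)=\inf_{\pi}\int_{\overline U\times\overline U}|x-y|^s\,d\pi(x,y),$$ the infimum being over all $\pi\in P(\overline U\times\overline U)$ with marginals $\mu$ and $\nu$, and $W_s(\mu,P(\partial U))=\inf_{\nu\in P(\partial U)}W_s(\mu,\nu)$.
   Context: For a set $A$, $P(A)$ denotes the set of Borel probability measures on $A$; measures on $\partial U$ are regarded as measures on $\overline U$. For $1<p<+\infty$, $$\lambda^D_{s,p}=\inf\Big\{[u]_{s,p}^p : u\in\widetilde W^{s,p}(U),\ \int_U|u|^p\,dx=1\Big\},\qquad [u]_{s,p}^p=\int_{\mathbb{R}^n}\int_{\mathbb{R}^n}\frac{|u(x)-u(y)|^p}{|x-y|^{n+sp}}\,dx\,dy,$$ where $\widetilde W^{s,p}(U)=\{u\in W^{s,p}(\mathbb{R}^n): u=0 \text{ in }\mathbb{R}^n\setminus U\}$. The limit $\Lambda^D_{s,\infty}=\lim_{p\to+\infty}(\lambda^D_{s,p})^{1/p}$ is known to exist and to be positive and finite. *)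

theory Defs
  imports "HOL-Probability.Probability"
begin

text \<open>Throughout, \<open>'a\<close> is Euclidean space of dimension \<open>n = DIM('a)\<close>.\<close>

section \<open>Smooth bounded domains\<close>

text \<open>\<open>C\<^sup>k\<close> functions on an open set \<open>S\<close>, through iterated partial derivatives.\<close>

primrec Ck_on :: "nat \<Rightarrow> 'a::euclidean_space set \<Rightarrow> ('a \<Rightarrow> real) \<Rightarrow> bool" where
  "Ck_on 0 S f \<longleftrightarrow> continuous_on S f"
| "Ck_on (Suc k) S f \<longleftrightarrow>
     f differentiable_on S \<and> (\<forall>b\<in>Basis. Ck_on k S (\<lambda>x. frechet_derivative f (at x) b))"

definition smooth_on :: "'a::euclidean_space set \<Rightarrow> ('a \<Rightarrow> real) \<Rightarrow> bool" where
  "smooth_on S f \<longleftrightarrow> (\<forall>k. Ck_on k S f)"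

text \<open>Near each boundary point, in suitable orthonormal coordinates with last axis \<open>e\<close>,
  the set is the strict epigraph of a smooth function of the other \<open>n - 1\<close> coordinates.
  A smooth function on the hyperplane orthogonal to \<open>e\<close> is the same thing as the restriction
  to that hyperplane of a smooth function on the whole space, so \<open>\<gamma>\<close> is taken on all of \<open>'a\<close>
  and evaluated at the orthogonal projection of \<open>x\<close>.\<close>

definition smooth_boundary :: "'a::euclidean_space set \<Rightarrow> bool" where
  "smooth_boundary U \<longleftrightarrow>
     (\<forall>x0\<in>frontier U. \<exists>r>0. \<exists>e \<gamma>. norm e = 1 \<and> smooth_on UNIV \<gamma> \<and>
        U \<inter> ball x0 r = {x \<in> ball x0 r. x \<bullet> e > \<gamma> (x - (x \<bullet> e) *\<^sub>R e)})"

definition smooth_bounded_domain :: "'a::euclidean_space set \<Rightarrow> bool" where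
  "smooth_bounded_domain U \<longleftrightarrow>
     U \<noteq> {} \<and> open U \<and> connected U \<and> bounded U \<and> smooth_boundary U"

section \<open>Fractional Sobolev spaces and the first Dirichlet eigenvalue\<close>

text \<open>The diagonal is Lebesgue-null, so the value \<open>0 / 0 = 0\<close> of the integrand there is
  immaterial.\<close>

definition gagliardo :: "real \<Rightarrow> real \<Rightarrow> ('a::euclidean_space \<Rightarrow> real) \<Rightarrow> ennreal" where
  "gagliardo s p u =
     (\<integral>\<^sup>+ x. (\<integral>\<^sup>+ y. ennreal (\<bar>u x - u y\<bar> powr p / norm (x - y) powr (real DIM('a) + s * p))
        \<partial>lborel) \<partial>lborel)"

text \<open>Elements of \<open>W\<^sup>s\<^sup>,\<^sup>p\<close> are represented by Borel functions: every Lebesgue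
  measurable function agrees almost everywhere with a Borel one, and all conditions and
  quantities below are invariant under changes on null sets.\<close>

definition sobolev :: "real \<Rightarrow> real \<Rightarrow> ('a::euclidean_space \<Rightarrow> real) set" where
  "sobolev s p = {u \<in> borel_measurable borel.
     (\<integral>\<^sup>+ x. ennreal (\<bar>u x\<bar> powr p) \<partial>lborel) < \<infinity> \<and> gagliardo s p u < \<infinity>}"

definition sobolev_dirichlet ::
    "real \<Rightarrow> real \<Rightarrow> 'a::euclidean_space set \<Rightarrow> ('a \<Rightarrow> real) set" where
  "sobolev_dirichlet s p U = {u \<in> sobolev s p. AE x in lborel. x \<notin> U \<longrightarrow> u x = 0}"

definition eigenvalue_dirichlet :: "real \<Rightarrow> real \<Rightarrow> 'a::euclidean_space set \<Rightarrow> real" where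
  "eigenvalue_dirichlet s p U =
     Inf {enn2real (gagliardo s p u) | u.
            u \<in> sobolev_dirichlet s p U \<and> (LINT x:U|lborel. \<bar>u x\<bar> powr p) = 1}"

definition Lambda_dirichlet :: "real \<Rightarrow> 'a::euclidean_space set \<Rightarrow> real" where
  "Lambda_dirichlet s U = Lim at_top (\<lambda>p. eigenvalue_dirichlet s p U powr (1 / p))"

section \<open>Optimal transport\<close>

text \<open>Borel probability measures on a Borel set \<open>A\<close> are represented by Borel probability
  measures on the ambient space that are concentrated on \<open>A\<close>. Measures on the boundary are
  thereby literally also measures on the closure.\<close>

definition borel_probs :: "'a::topological_space set \<Rightarrow> 'a measure set" where
  "borel_probs A = {\<mu>. prob_space \<mu> \<and> sets \<mu> = sets borel \<and> emeasure \<mu> A = 1}"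

definition couplings ::
    "'a::euclidean_space set \<Rightarrow> 'a measure \<Rightarrow> 'a measure \<Rightarrow> ('a \<times> 'a) measure set" where
  "couplings K \<mu> \<nu> =
     {\<pi> \<in> borel_probs (K \<times> K). distr \<pi> borel fst = \<mu> \<and> distr \<pi> borel snd = \<nu>}"

definition transport_cost ::
    "real \<Rightarrow> 'a::euclidean_space set \<Rightarrow> 'a measure \<Rightarrow> 'a measure \<Rightarrow> real" where
  "transport_cost s K \<mu> \<nu> =
     (INF \<pi> \<in> couplings K \<mu> \<nu>. LINT z:K \<times> K|\<pi>. norm (fst z - snd z) powr s)"

definition transport_cost_to ::
    "real \<Rightarrow> 'a::euclidean_space set \<Rightarrow> 'a measure \<Rightarrow> 'a measure set \<Rightarrow> real" where
  "transport_cost_to s K \<mu> N = (INF \<nu> \<in> N. transport_cost s K \<mu> \<nu>)"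

end

theory Submission
  imports Defs
begin

text \<open>Both sides equal \<open>R\<^sup>s\<close>, where \<open>R\<close> is the maximum over \<open>closure U\<close> of the distance to
  the boundary, attained at \<open>x\<^sub>0\<close>. For the transport side, moving mass to (almost) nearest boundary
  points costs at most \<open>R\<^sup>s\<close>, and the Dirac mass at \<open>x\<^sub>0\<close> cannot be moved there for less.

  For the eigenvalues, the cone \<open>u(x) = max 0 (R - |x - x\<^sub>0|)\<close> satisfies
  \<open>|u(x) - u(y)| \<le> min R |x - y|\<close>, hence has \<open>s\<close>-Hoelder constant \<open>R\<close> to the power \<open>1 - s\<close>
  and maximum \<open>R\<close>; being Lipschitz, it has a seminorm that differs from this constant only by a
  factor tending to 1 as \<open>p \<rightarrow> \<infinity>\<close>. Conversely, no Morrey embedding or compactness argument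
  is needed: since the boundary is smooth, \<open>U\<close> is covered by finitely many balls \<open>ball z (R + \<delta>)\<close>
  such that \<open>ball z \<rho>\<close> is disjoint from \<open>U\<close>. An admissible \<open>u\<close> vanishes on \<open>ball z \<rho>\<close>, so
  restricting the Gagliardo integral to \<open>ball z (R + \<delta>) \<times> ball z \<rho>\<close> bounds the integral of
  \<open>|u|\<^sup>p\<close> over \<open>U \<inter> ball z (R + \<delta>)\<close>. The number of balls and \<open>\<rho>\<close> do not depend on \<open>p\<close>
  and disappear in the \<open>p\<close>-th root.\<close>

section \<open>Distance to the boundary\<close>

lemma smooth_bounded_domain_frontier_nonempty:
  fixes U :: "'a::euclidean_space set"
  assumes "smooth_bounded_domain U"
  shows "frontier U \<noteq> {}"
proof -
  have "U \<noteq> {}" "bounded U"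
    using assms by (auto simp: smooth_bounded_domain_def)
  then show ?thesis
    by (auto simp: frontier_eq_empty not_bounded_UNIV)
qed

text \<open>Smoothness of the boundary enters here. Near a boundary point \<open>U\<close> lies
  strictly above a graph, and continuity of \<open>\<gamma>\<close> makes the strict subgraph open.
  An open set disjoint from \<open>U\<close> also misses \<open>closure U\<close>, so a small step
  in direction \<open>- e\<close> leaves the closure. Slits and punctures, which no exterior ball
  could approach, are thereby excluded.\<close>

lemma smooth_boundary_frontier_subset_closure_exterior:
  fixes U :: "'a::euclidean_space set"
  assumes "open U" "smooth_boundary U"
  shows "frontier U \<subseteq> closure (- closure U)"
proof
  fix y assume y: "y \<in> frontier U"
  then obtain r e \<gamma> where r: "r > 0" and e: "norm e = 1" and \<gamma>: "smooth_on UNIV \<gamma>"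
    and eq: "U \<inter> ball y r = {x \<in> ball y r. x \<bullet> e > \<gamma> (x - (x \<bullet> e) *\<^sub>R e)}"
    using assms(2) unfolding smooth_boundary_def by blast
  have ee: "e \<bullet> e = 1" using e by (simp add: dot_square_norm)
  have "Ck_on 0 UNIV \<gamma>"
    using \<gamma> unfolding smooth_on_def by blast
  then have cont: "continuous_on UNIV \<gamma>" by simp
  have "y \<notin> U" using y \<open>open U\<close> by (simp add: frontier_def interior_open)
  then have y_le: "y \<bullet> e \<le> \<gamma> (y - (y \<bullet> e) *\<^sub>R e)"
    using eq r by fastforce
  let ?V = "ball y r \<inter> {x. x \<bullet> e < \<gamma> (x - (x \<bullet> e) *\<^sub>R e)}"
  have "continuous_on UNIV (\<lambda>x. \<gamma> (x - (x \<bullet> e) *\<^sub>R e))"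
    by (rule continuous_on_compose2[OF cont]) (auto intro!: continuous_intros)
  then have "open {x. x \<bullet> e < \<gamma> (x - (x \<bullet> e) *\<^sub>R e)}"
    by (intro open_Collect_less continuous_intros) auto
  then have "open ?V" by blast
  moreover have "?V \<inter> U = {}"
  proof -
    have "x \<bullet> e > \<gamma> (x - (x \<bullet> e) *\<^sub>R e)" if "x \<in> ball y r" "x \<in> U" for x
      using eq that by blast
    then show ?thesis by fastforce
  qed
  ultimately have "?V \<inter> closure U = {}"
    by (simp add: open_Int_closure_eq_empty)
  then have V: "?V \<subseteq> - closure U" by blast
  show "y \<in> closure (- closure U)"
    unfolding closure_approachable
  proof (intro allI impI)
    fix d :: real assume "d > 0"
    define t where "t = min d r / 2"
    have t: "t > 0" "t < d" "t < r" using \<open>d > 0\<close> r by (auto simp: t_def)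
    let ?z = "y - t *\<^sub>R e"
    have ze: "?z \<bullet> e = y \<bullet> e - t" by (simp add: inner_diff_left ee)
    \<comment> \<open>A shift along \<open>e\<close> keeps the orthogonal projection, so the height
      drops by \<open>t\<close> while the graph value stays the same.\<close>
    have "?z - (?z \<bullet> e) *\<^sub>R e = y - (y \<bullet> e) *\<^sub>R e"
      unfolding ze by (simp add: algebra_simps)
    then have "\<gamma> (?z - (?z \<bullet> e) *\<^sub>R e) = \<gamma> (y - (y \<bullet> e) *\<^sub>R e)"
      by (rule arg_cong)
    then have "?z \<bullet> e < \<gamma> (?z - (?z \<bullet> e) *\<^sub>R e)"
      using y_le t ze by linarith
    moreover have d: "dist ?z y = t" using t e by (simp add: dist_norm)
    ultimately have "?z \<in> ?V" using t by (simp add: dist_commute)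
    then have "?z \<in> - closure U" using V by blast
    then show "\<exists>z\<in>- closure U. dist z y < d" using d t by (intro bexI[of _ ?z]) simp_all
  qed
qed

text \<open>A point of \<open>closure U\<close> is within \<open>R\<close> of the boundary, and
  boundary points are arbitrarily close to the exterior; this gives the radius
  \<open>R + \<delta>\<close>. Compactness leaves finitely many exterior centres, and each has a
  small ball free of \<open>U\<close>, on which admissible functions will vanish.\<close>

lemma exterior_ball_cover:
  fixes U :: "'a::euclidean_space set"
  assumes U: "smooth_bounded_domain U" and \<delta>: "0 < \<delta>"
    and R: "\<And>x. x \<in> closure U \<Longrightarrow> infdist x (frontier U) \<le> R"
  obtains Z \<rho> where "finite Z" "0 < \<rho>" "\<rho> \<le> \<delta>"
    "U \<subseteq> (\<Union>z\<in>Z. ball z (R + \<delta>))" "\<And>z. z \<in> Z \<Longrightarrow> ball z \<rho> \<inter> U = {}"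
proof -
  have "compact (closure U)" and openU: "open U" "smooth_boundary U"
    using U by (auto simp: smooth_bounded_domain_def)
  moreover have "closure U \<subseteq> (\<Union>z\<in>- closure U. ball z (R + \<delta>))"
  proof
    fix x assume x: "x \<in> closure U"
    obtain y where y: "y \<in> frontier U" "infdist x (frontier U) = dist x y"
      using infdist_attains_inf[of "frontier U"] smooth_bounded_domain_frontier_nonempty[OF U]
      by auto
    obtain z where z: "z \<in> - closure U" "dist z y < \<delta>"
      using smooth_boundary_frontier_subset_closure_exterior[OF openU] y(1) \<delta>
      unfolding closure_approachable subset_iff by blast
    have "dist z x \<le> dist z y + dist x y" by (rule dist_triangle2)
    also have "\<dots> < R + \<delta>" using z R[OF x] y by linarith
    finally show "x \<in> (\<Union>z\<in>- closure U. ball z (R + \<delta>))" using z by auto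
  qed
  ultimately obtain Z where Z: "Z \<subseteq> - closure U" "finite Z" "closure U \<subseteq> (\<Union>z\<in>Z. ball z (R + \<delta>))"
    by (elim compactE_image[where C = "- closure U"]) auto
  have "\<exists>\<rho>>0. ball z \<rho> \<inter> U = {}" if "z \<in> Z" for z
  proof -
    have "open (- closure U)" "z \<in> - closure U" using Z that by auto
    then obtain \<rho> where "\<rho> > 0" "ball z \<rho> \<subseteq> - closure U"
      unfolding open_contains_ball by blast
    then show ?thesis using closure_subset by blast
  qed
  then obtain f where f: "\<And>z. z \<in> Z \<Longrightarrow> f z > 0 \<and> ball z (f z) \<inter> U = {}" by metis
  \<comment> \<open>Inserting \<open>\<delta>\<close> enforces \<open>\<rho> \<le> \<delta>\<close>
    and keeps the argument of \<open>Min\<close> nonempty.\<close>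
  define \<rho> where "\<rho> = Min (insert \<delta> (f ` Z))"
  have "0 < \<rho>" using Z(2) f \<delta> by (auto simp: \<rho>_def)
  moreover have "\<rho> \<le> \<delta>" using Z(2) by (simp add: \<rho>_def)
  moreover have "ball z \<rho> \<inter> U = {}" if "z \<in> Z" for z
  proof -
    have "\<rho> \<le> f z" using Z(2) that by (simp add: \<rho>_def)
    then show ?thesis using f[OF that] subset_ball by blast
  qed
  ultimately show thesis using Z closure_subset[of U] by (intro that[of Z \<rho>]) blast+
qed

text \<open>The distance to the frontier attains its maximum on the compact closure. The ball of
  that radius misses the frontier, and a connected set that meets \<open>U\<close> but not its
  frontier lies in \<open>U\<close>. The ball will carry the cone; the maximality serves the
  covering and the transport bound.\<close>

lemma deepest_point:
  fixes U :: "'a::euclidean_space set"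
  assumes U: "smooth_bounded_domain U"
  obtains x0 where "x0 \<in> U" "0 < infdist x0 (frontier U)"
    "ball x0 (infdist x0 (frontier U)) \<subseteq> U"
    "\<And>x. x \<in> closure U \<Longrightarrow> infdist x (frontier U) \<le> infdist x0 (frontier U)"
proof -
  have ne: "frontier U \<noteq> {}" by (rule smooth_bounded_domain_frontier_nonempty[OF U])
  have comp: "compact (closure U)" and U': "U \<noteq> {}" "open U"
    using U by (auto simp: smooth_bounded_domain_def)
  have "continuous_on (closure U) (\<lambda>x. infdist x (frontier U))"
    by (intro continuous_intros)
  then obtain x0 where x0: "x0 \<in> closure U"
    and max: "\<And>x. x \<in> closure U \<Longrightarrow> infdist x (frontier U) \<le> infdist x0 (frontier U)"
    using continuous_attains_sup[OF comp, of "\<lambda>x. infdist x (frontier U)"] U' by auto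
  have pos: "0 < infdist x (frontier U)" if "x \<in> U" for x
  proof -
    have "x \<notin> frontier U" using that U' by (simp add: frontier_def interior_open)
    then have "infdist x (frontier U) \<noteq> 0"
      using in_closed_iff_infdist_zero[of "frontier U" x] ne by simp
    then show ?thesis using infdist_nonneg[of x "frontier U"] by linarith
  qed
  have pos0: "0 < infdist x0 (frontier U)"
    using U' pos max closure_subset[of U] by (meson equals0I less_le_trans subsetD)
  have "x0 \<notin> frontier U" using pos0 by auto
  then have x0U: "x0 \<in> U" using x0 U' by (simp add: frontier_def interior_open)
  have "ball x0 (infdist x0 (frontier U)) \<inter> frontier U = {}"
  proof (rule ccontr)
    assume "ball x0 (infdist x0 (frontier U)) \<inter> frontier U \<noteq> {}"
    then obtain y where "y \<in> frontier U" "dist x0 y < infdist x0 (frontier U)" by auto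
    then show False using infdist_le[of y "frontier U" x0] by simp
  qed
  then have "ball x0 (infdist x0 (frontier U)) \<subseteq> U"
    using connected_Int_frontier[of "ball x0 (infdist x0 (frontier U))" U] x0U pos0
      centre_in_ball[of x0 "infdist x0 (frontier U)"] by (metis Diff_eq_empty_iff IntI connected_ball empty_iff)
  with x0U pos0 max show thesis by (intro that[of x0]) auto
qed

section \<open>Transport to the boundary\<close>

lemma fst_borel: "fst \<in> borel_measurable (borel :: ('a::second_countable_topology \<times> 'b::second_countable_topology) measure)"
  and snd_borel: "snd \<in> borel_measurable (borel :: ('a \<times> 'b) measure)"
  unfolding borel_prod[symmetric] by (rule measurable_fst measurable_snd)+

lemma couplings_imp_prob_spaces:
  assumes "\<pi> \<in> couplings K \<mu> \<nu>"
  shows "prob_space \<pi>" "sets \<pi> = sets borel" "AE z in \<pi>. z \<in> K \<times> K"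
    "distr \<pi> borel fst = \<mu>" "distr \<pi> borel snd = \<nu>"
proof -
  show *: "prob_space \<pi>" "sets \<pi> = sets borel" "distr \<pi> borel fst = \<mu>" "distr \<pi> borel snd = \<nu>"
    using assms by (auto simp: couplings_def borel_probs_def)
  have em: "emeasure \<pi> (K \<times> K) = 1"
    using assms by (auto simp: couplings_def borel_probs_def)
  \<comment> \<open>A nonmeasurable set has \<open>emeasure\<close> zero by convention, so the value
    \<open>1\<close> forces measurability.\<close>
  then have "K \<times> K \<in> sets \<pi>" using emeasure_notin_sets by fastforce
  then show "AE z in \<pi>. z \<in> K \<times> K"
    using prob_space.AE_in_set_eq_1[OF *(1)] em by (simp add: measure_def)
qed

lemma borel_probs_AE:
  assumes "\<mu> \<in> borel_probs A"
  shows "AE x in \<mu>. x \<in> A"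
proof -
  have p: "prob_space \<mu>" and em: "emeasure \<mu> A = 1"
    using assms by (auto simp: borel_probs_def)
  then have "A \<in> sets \<mu>" using emeasure_notin_sets by fastforce
  then show ?thesis
    using prob_space.AE_in_set_eq_1[OF p] em by (simp add: measure_def)
qed

text \<open>The cost is bounded by \<open>diameter K powr s\<close>. A Bochner integral defaults to
  \<open>0\<close> without integrability, so this is what licenses the pointwise comparisons of
  costs below.\<close>

lemma couplings_integrable:
  fixes K :: "'a::euclidean_space set"
  assumes K: "compact K" and s: "0 < s" and \<pi>: "\<pi> \<in> couplings K \<mu> \<nu>"
  shows "set_integrable \<pi> (K \<times> K) (\<lambda>z. norm (fst z - snd z) powr s)"
proof -
  note [measurable_cong] = couplings_imp_prob_spaces(2)[OF \<pi>]
  interpret prob_space \<pi> by (rule couplings_imp_prob_spaces[OF \<pi>])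
  have [measurable]: "K \<times> K \<in> sets borel"
    using K by (intro borel_closed closed_Times compact_imp_closed)
  have [measurable]: "(\<lambda>z::'a\<times>'a. norm (fst z - snd z) powr s) \<in> borel_measurable borel"
    unfolding borel_prod[symmetric] by measurable
  show ?thesis
    unfolding set_integrable_def
  proof (rule integrable_const_bound)
    show "AE z in \<pi>. norm (indicator (K \<times> K) z *\<^sub>R norm (fst z - snd z) powr s)
        \<le> diameter K powr s"
      using s K diameter_bounded_bound[OF compact_imp_bounded[OF K]]
      by (intro AE_I2) (auto simp: indicator_def dist_norm intro!: powr_mono2)
  qed measurable
qed

text \<open>A real infimum is meaningful only over a nonempty set that is bounded below; this
  supplies the bound, and \<open>couplings_product\<close> the nonemptiness.\<close>

lemma transport_cost_bdd_below:
  "bdd_below ((\<lambda>\<pi>. LINT z:K \<times> K|\<pi>. norm (fst z - snd z) powr s) ` couplings K \<mu> \<nu>)"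
  by (rule bdd_belowI[of _ 0])
     (auto simp: set_lebesgue_integral_def intro!: integral_nonneg_AE)

lemma transport_cost_nonneg:
  assumes "couplings K \<mu> \<nu> \<noteq> {}"
  shows "0 \<le> transport_cost s K \<mu> \<nu>"
  unfolding transport_cost_def
  by (rule cINF_greatest[OF assms])
     (auto simp: set_lebesgue_integral_def intro!: integral_nonneg_AE)

text \<open>The independent coupling, which witnesses that two given marginals can always be
  coupled.\<close>

lemma couplings_product:
  fixes K :: "'a::euclidean_space set"
  assumes K: "closed K" "A \<subseteq> K" and \<mu>: "\<mu> \<in> borel_probs K" and \<nu>: "\<nu> \<in> borel_probs A"
  shows "\<mu> \<Otimes>\<^sub>M \<nu> \<in> couplings K \<mu> \<nu>"
proof -
  have [measurable_cong]: "sets \<mu> = sets borel" "sets \<nu> = sets borel"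
    using \<mu> \<nu> by (auto simp: borel_probs_def)
  interpret m: prob_space \<mu> using \<mu> by (auto simp: borel_probs_def)
  interpret n: prob_space \<nu> using \<nu> by (auto simp: borel_probs_def)
  interpret pair_prob_space \<mu> \<nu> ..
  have K': "K \<in> sets \<nu>" "K \<in> sets \<mu>" using K by auto
  have "AE x in \<nu>. x \<in> K" using borel_probs_AE[OF \<nu>] K by auto
  then have "emeasure \<nu> K = 1" using K n.emeasure_eq_1_AE[of K] K' by simp
  moreover have "emeasure \<mu> K = 1" using \<mu> by (auto simp: borel_probs_def)
  ultimately have "emeasure (\<mu> \<Otimes>\<^sub>M \<nu>) (K \<times> K) = 1"
    using K' by (simp add: n.emeasure_pair_measure_Times)
  moreover have "sets (\<mu> \<Otimes>\<^sub>M \<nu>) = sets borel"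
    by (subst borel_prod[symmetric]) (intro sets_pair_measure_cong; fact)
  moreover have "distr (\<mu> \<Otimes>\<^sub>M \<nu>) borel fst = \<mu>"
  proof -
    have "distr (\<mu> \<Otimes>\<^sub>M \<nu>) borel fst = distr (\<mu> \<Otimes>\<^sub>M \<nu>) \<mu> fst"
      by (rule distr_cong) (use \<mu> in \<open>auto simp: borel_probs_def\<close>)
    then show ?thesis by (simp add: n.distr_pair_fst)
  qed
  moreover have "distr (\<mu> \<Otimes>\<^sub>M \<nu>) borel snd = \<nu>"
  proof -
    have "distr (\<mu> \<Otimes>\<^sub>M \<nu>) borel snd = distr (\<mu> \<Otimes>\<^sub>M \<nu>) \<nu> snd"
      by (rule distr_cong) (use \<nu> in \<open>auto simp: borel_probs_def\<close>)
    \<comment> \<open>Swapping the factors reduces the second marginal to the first.\<close>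
    also have "\<dots> = distr (\<nu> \<Otimes>\<^sub>M \<mu>) \<nu> fst"
      by (subst distr_pair_swap, subst distr_distr) (auto simp: comp_def split_beta)
    finally show ?thesis by (simp add: m.distr_pair_fst)
  qed
  ultimately show ?thesis
    using prob_space_axioms by (auto simp: couplings_def borel_probs_def)
qed

section \<open>Cost of moving mass to the boundary\<close>

text \<open>The slack in \<open>infdist x F < r\<close> allows a finite net of \<open>F\<close> by
  compactness. Choosing the first suitable net point is then visibly measurable, so no measurable
  selection of exact nearest points has to be made.\<close>

lemma almost_nearest_point_map:
  fixes F :: "'a::euclidean_space set"
  assumes K: "compact K" and F: "closed F" "F \<noteq> {}"
    and r: "\<And>x. x \<in> K \<Longrightarrow> infdist x F < r"
  obtains T where "T \<in> borel_measurable borel" "\<And>x. T x \<in> F" "\<And>x. x \<in> K \<Longrightarrow> dist (T x) x < r"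
proof -
  have "K \<subseteq> (\<Union>y\<in>F. ball y r)"
  proof
    fix x assume "x \<in> K"
    moreover obtain y where "y \<in> F" "infdist x F = dist x y"
      using infdist_attains_inf[OF F] by blast
    ultimately show "x \<in> (\<Union>y\<in>F. ball y r)" using r[of x] by (auto simp: dist_commute)
  qed
  then obtain Y0 where Y0: "Y0 \<subseteq> F" "finite Y0" "K \<subseteq> (\<Union>y\<in>Y0. ball y r)"
    using K by (elim compactE_image[where C = F]) auto
  obtain y0 where "y0 \<in> F" using F by blast
  \<comment> \<open>The extra point covers the case of an empty net: \<open>from_nat_into\<close>
    enumerates only nonempty sets.\<close>
  define Y where "Y = insert y0 Y0"
  have Y: "Y \<subseteq> F" "countable Y" "Y \<noteq> {}" "K \<subseteq> (\<Union>y\<in>Y. ball y r)"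
    using Y0 \<open>y0 \<in> F\<close> by (auto simp: Y_def countable_finite)
  define y where "y = from_nat_into Y"
  \<comment> \<open>Where no net point is close enough, \<open>LEAST\<close> gives an unspecified
    index, but the value still lies in \<open>Y\<close> and hence in \<open>F\<close>.\<close>
  define T where "T = (\<lambda>x. y (LEAST i. dist (y i) x < r))"
  have "T \<in> borel_measurable borel"
    unfolding T_def by measurable
  moreover have "T x \<in> F" for x
    using from_nat_into[OF Y(3)] Y(1) by (auto simp: T_def y_def)
  moreover have "dist (T x) x < r" if "x \<in> K" for x
  proof -
    obtain w where "w \<in> Y" "dist w x < r"
      using subsetD[OF Y(4) \<open>x \<in> K\<close>] by auto
    then obtain i where "dist (y i) x < r"
      using from_nat_into_surj[OF Y(2)] unfolding y_def by blast
    then show ?thesis unfolding T_def by (rule LeastI)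
  qed
  ultimately show thesis by (rule that)
qed

text \<open>For every \<open>r > R\<close> the push-forward of \<open>\<mu>\<close> under an almost
  nearest point map is a competitor of cost at most \<open>r powr s\<close>; then \<open>r\<close>
  decreases to \<open>R\<close>.\<close>

lemma transport_cost_to_le:
  fixes K :: "'a::euclidean_space set"
  assumes K: "compact K" and F: "closed F" "F \<noteq> {}" "F \<subseteq> K" and s: "0 < s"
    and \<mu>: "\<mu> \<in> borel_probs K"
    and R: "\<And>x. x \<in> K \<Longrightarrow> infdist x F \<le> R"
  shows "transport_cost_to s K \<mu> (borel_probs F) \<le> R powr s"
proof -
  have [measurable_cong]: "sets \<mu> = sets borel" using \<mu> by (auto simp: borel_probs_def)
  interpret prob_space \<mu> using \<mu> by (auto simp: borel_probs_def)
  have [measurable]: "K \<in> sets borel" "F \<in> sets borel" "K \<times> K \<in> sets borel"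
    using K F by (auto intro!: borel_closed closed_Times intro: compact_imp_closed)
  have R0: "0 \<le> R"
  proof -
    obtain x where "x \<in> K" using F by blast
    then show ?thesis using R[of x] infdist_nonneg[of x F] by linarith
  qed
  have le: "transport_cost_to s K \<mu> (borel_probs F) \<le> r powr s" if r: "R < r" for r
  proof -
    have "\<And>x. x \<in> K \<Longrightarrow> infdist x F < r" using R r by (meson le_less_trans)
    then obtain T where T[measurable]: "T \<in> borel_measurable borel"
      and TF: "\<And>x. T x \<in> F" and Tr: "\<And>x. x \<in> K \<Longrightarrow> dist (T x) x < r"
      using almost_nearest_point_map[OF K F(1,2)] by blast
    define \<nu> where "\<nu> = distr \<mu> borel T"
    \<comment> \<open>The deterministic plan, concentrated on the graph of \<open>T\<close>.\<close>
    define \<pi> where "\<pi> = distr \<mu> borel (\<lambda>x. (x, T x))"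
    have pair[measurable]: "(\<lambda>x. (x, T x)) \<in> measurable \<mu> borel"
      by (simp add: borel_prod[symmetric])
    have AE_K: "AE x in \<mu>. x \<in> K" by (rule borel_probs_AE[OF \<mu>])
    have "emeasure \<nu> F = 1"
      unfolding \<nu>_def by (subst emeasure_distr) (auto intro!: emeasure_eq_1_AE TF)
    then have \<nu>: "\<nu> \<in> borel_probs F"
      unfolding borel_probs_def \<nu>_def by (auto intro!: prob_space_distr)
    have "emeasure \<pi> (K \<times> K) = 1"
      unfolding \<pi>_def using TF F(3) AE_K
      by (subst emeasure_distr) (auto intro!: emeasure_eq_1_AE)
    moreover have "distr \<pi> borel fst = \<mu>"
      unfolding \<pi>_def using \<mu>
      by (subst distr_distr[OF fst_borel pair])
         (auto simp: comp_def borel_probs_def intro!: distr_id2)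
    moreover have "distr \<pi> borel snd = \<nu>"
      unfolding \<pi>_def \<nu>_def by (subst distr_distr[OF snd_borel pair]) (simp add: comp_def)
    ultimately have \<pi>: "\<pi> \<in> couplings K \<mu> \<nu>"
      unfolding couplings_def borel_probs_def \<pi>_def by (auto intro!: prob_space_distr)
    interpret p: prob_space \<pi> by (rule couplings_imp_prob_spaces[OF \<pi>])
    have "AE z in \<pi>. dist (fst z) (snd z) < r"
    proof -
      have "open {z::'a \<times> 'a. dist (fst z) (snd z) < r}"
        by (intro open_Collect_less continuous_intros)
      then show ?thesis
        unfolding \<pi>_def using AE_K Tr
        by (subst AE_distr_iff) (auto simp: dist_commute)
    qed
    then have "AE z in \<pi>. indicator (K \<times> K) z *\<^sub>R norm (fst z - snd z) powr s \<le> r powr s"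
    proof eventually_elim
      case (elim z)
      then have "norm (fst z - snd z) powr s \<le> r powr s"
        using s by (intro powr_mono2) (auto simp: dist_norm)
      then show ?case by (cases "z \<in> K \<times> K") auto
    qed
    then have "(LINT z:K \<times> K|\<pi>. norm (fst z - snd z) powr s) \<le> (LINT z|\<pi>. r powr s)"
      unfolding set_lebesgue_integral_def
      using couplings_integrable[OF K s \<pi>]
      by (intro integral_mono_AE) (simp_all add: set_integrable_def)
    also have "\<dots> = r powr s" by (simp add: p.prob_space)
    finally have "transport_cost s K \<mu> \<nu> \<le> r powr s"
      unfolding transport_cost_def
      by (rule cINF_lower2[OF transport_cost_bdd_below \<pi>])
    moreover have "bdd_below (transport_cost s K \<mu> ` borel_probs F)"
    proof (rule bdd_belowI2[of _ 0])
      fix \<nu>' assume "\<nu>' \<in> borel_probs F"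
      then have "couplings K \<mu> \<nu>' \<noteq> {}"
        using couplings_product[OF compact_imp_closed[OF K] F(3) \<mu>] by blast
      then show "0 \<le> transport_cost s K \<mu> \<nu>'" by (rule transport_cost_nonneg)
    qed
    ultimately show ?thesis
      unfolding transport_cost_to_def using \<nu> by (meson cINF_lower2)
  qed
  \<comment> \<open>\<open>R\<close> may be \<open>0\<close>, so continuity of the power at this
    endpoint rests on \<open>0 < s\<close> and on approach from the right.\<close>
  have "((\<lambda>r. r powr s) \<longlongrightarrow> R powr s) (at_right R)"
    using s R0 by (intro tendsto_intros tendsto_powr') (auto simp: eventually_at_filter)
  then show ?thesis
    by (rule tendsto_lowerbound) (auto simp: eventually_at_filter intro!: always_eventually le)
qed

text \<open>A Dirac marginal leaves no freedom: under any plan the first coordinate is almost surely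
  \<open>x\<close> and the second lies in \<open>F\<close>, so the integrand is almost surely at
  least the claimed constant.\<close>

lemma transport_cost_to_return_ge:
  fixes K :: "'a::euclidean_space set"
  assumes K: "compact K" and F: "closed F" "F \<noteq> {}" "F \<subseteq> K" and s: "0 < s" and x: "x \<in> K"
  shows "infdist x F powr s \<le> transport_cost_to s K (return borel x) (borel_probs F)"
  unfolding transport_cost_to_def
proof (rule cINF_greatest)
  obtain y where "y \<in> F" using F by blast
  have [measurable]: "K \<in> sets borel" "F \<in> sets borel" "K \<times> K \<in> sets borel"
    using K F by (auto intro!: borel_closed closed_Times intro: compact_imp_closed)
  show "borel_probs F \<noteq> {}"
  proof -
    have "return borel y \<in> borel_probs F"
      using \<open>y \<in> F\<close> by (simp add: borel_probs_def prob_space_return)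
    then show ?thesis by blast
  qed
  have rx: "return borel x \<in> borel_probs K"
    using x by (simp add: borel_probs_def prob_space_return)
  fix \<nu> assume \<nu>: "\<nu> \<in> borel_probs F"
  show "infdist x F powr s \<le> transport_cost s K (return borel x) \<nu>"
    unfolding transport_cost_def
  proof (rule cINF_greatest)
    show "couplings K (return borel x) \<nu> \<noteq> {}"
      using couplings_product[OF compact_imp_closed[OF K] F(3) rx \<nu>] by blast
    fix \<pi> assume \<pi>: "\<pi> \<in> couplings K (return borel x) \<nu>"
    note cp = couplings_imp_prob_spaces[OF \<pi>]
    note [measurable_cong] = cp(2)
    interpret prob_space \<pi> by (rule cp)
    have [measurable]: "fst \<in> \<pi> \<rightarrow>\<^sub>M borel" "snd \<in> \<pi> \<rightarrow>\<^sub>M borel"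
      using cp(2) by (simp_all add: borel_prod[symmetric] cong: measurable_cong_sets)
    have "AE z in distr \<pi> borel fst. z = x"
      unfolding cp by (simp add: AE_return)
    then have 1: "AE z in \<pi>. fst z = x" by (simp add: AE_distr_iff)
    have "AE z in distr \<pi> borel snd. z \<in> F"
      unfolding cp by (rule borel_probs_AE[OF \<nu>])
    then have 2: "AE z in \<pi>. snd z \<in> F" by (simp add: AE_distr_iff)
    have "infdist x F powr s = (LINT z|\<pi>. infdist x F powr s)" by (simp add: prob_space)
    also have "\<dots> \<le> (LINT z:K \<times> K|\<pi>. norm (fst z - snd z) powr s)"
      unfolding set_lebesgue_integral_def
    proof (rule integral_mono_AE)
      show "AE z in \<pi>. infdist x F powr s
          \<le> indicator (K \<times> K) z *\<^sub>R norm (fst z - snd z) powr s"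
        using 1 2 cp(3)
      proof eventually_elim
        case (elim z)
        then show ?case
          using s infdist_le[of "snd z" F x] infdist_nonneg[of x F]
          by (auto simp: dist_norm intro!: powr_mono2)
      qed
    qed (use couplings_integrable[OF K s \<pi>] in \<open>auto simp: set_integrable_def\<close>)
    finally show "infdist x F powr s \<le> (LINT z:K \<times> K|\<pi>. norm (fst z - snd z) powr s)" .
  qed
qed

lemma SUP_transport_cost_to:
  fixes K :: "'a::euclidean_space set"
  assumes K: "compact K" and F: "closed F" "F \<noteq> {}" "F \<subseteq> K" and s: "0 < s" and x0: "x0 \<in> K"
    and R: "\<And>x. x \<in> K \<Longrightarrow> infdist x F \<le> infdist x0 F"
  shows "(SUP \<mu> \<in> borel_probs K. transport_cost_to s K \<mu> (borel_probs F)) = infdist x0 F powr s"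
proof (rule antisym)
  have rx: "return borel x0 \<in> borel_probs K"
    using x0 K by (simp add: borel_probs_def prob_space_return borel_compact)
  have le: "transport_cost_to s K \<mu> (borel_probs F) \<le> infdist x0 F powr s"
    if "\<mu> \<in> borel_probs K" for \<mu>
    by (rule transport_cost_to_le[OF K F s that R])
  show "(SUP \<mu> \<in> borel_probs K. transport_cost_to s K \<mu> (borel_probs F)) \<le> infdist x0 F powr s"
    using rx le by (intro cSUP_least) auto
  have "bdd_above ((\<lambda>\<mu>. transport_cost_to s K \<mu> (borel_probs F)) ` borel_probs K)"
    using le by (rule bdd_aboveI2)
  then show "infdist x0 F powr s \<le> (SUP \<mu> \<in> borel_probs K. transport_cost_to s K \<mu> (borel_probs F))"
    using transport_cost_to_return_ge[OF K F s x0] rx by (meson cSUP_upper2)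
qed

section \<open>Asymptotics of the first eigenvalue\<close>

lemma nn_integral_lborel_translate:
  fixes f :: "'a::euclidean_space \<Rightarrow> ennreal"
  assumes [measurable]: "f \<in> borel_measurable borel"
  shows "(\<integral>\<^sup>+ y. f (y - x) \<partial>lborel) = (\<integral>\<^sup>+ y. f y \<partial>lborel)"
proof -
  have "(\<integral>\<^sup>+ y. f y \<partial>lborel) = (\<integral>\<^sup>+ y. f y \<partial>distr lborel borel ((+) (- x)))"
    by (simp add: lborel_distr_plus)
  also have "\<dots> = (\<integral>\<^sup>+ y. f (y - x) \<partial>lborel)"
    by (subst nn_integral_distr) auto
  finally show ?thesis by simp
qed

text \<open>Decomposition into dyadic shells, each enlarged to a ball. The volume grows like
  \<open>2 ^ j\<close> to the power \<open>n\<close> while the integrand decays with exponent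
  \<open>n + s\<close>, so a geometric series of ratio \<open>2 powr - s\<close> remains.\<close>

lemma nn_integral_power_tail_finite:
  fixes R s :: real
  assumes R: "0 < R" and s: "0 < s"
  shows "(\<integral>\<^sup>+ z. ennreal (norm z powr - (real DIM('a) + s)) * indicator (- ball 0 R) (z::'a::euclidean_space) \<partial>lborel) < \<infinity>"
proof -
  let ?n = "real DIM('a)"
  define c where "c j = (2 ^ j * R) powr - (?n + s)" for j :: nat
  let ?B = "\<lambda>j::nat. ball (0::'a) (2 ^ Suc j * R)"
  define \<omega> where "\<omega> = unit_ball_vol ?n"
  have "(\<integral>\<^sup>+ z. ennreal (norm z powr - (?n + s)) * indicator (- ball 0 R) (z::'a) \<partial>lborel)
      \<le> (\<integral>\<^sup>+ z. (\<Sum>j. ennreal (c j) * indicator (?B j) z) \<partial>lborel)"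
  proof (rule nn_integral_mono)
    fix z :: 'a
    show "ennreal (norm z powr - (?n + s)) * indicator (- ball 0 R) z
        \<le> (\<Sum>j. ennreal (c j) * indicator (?B j) z)"
    proof (cases "R \<le> norm z")
      case True
      have "\<exists>k. norm z < 2 ^ k * R"
        using real_arch_pow[of 2 "norm z / R"] R by (auto simp: field_simps)
      \<comment> \<open>As \<open>R \<le> norm z\<close>, the least such \<open>k\<close> is not
        \<open>0\<close>; its predecessor \<open>j\<close> is the index of the shell with
        \<open>2 ^ j * R \<le> norm z < 2 ^ Suc j * R\<close>.\<close>
      define k where "k = (LEAST k. norm z < 2 ^ k * R)"
      have k: "norm z < 2 ^ k * R"
        unfolding k_def by (rule LeastI_ex) fact
      have "k \<noteq> 0" using k True by (cases k) auto
      then obtain j where j: "k = Suc j" by (cases k) auto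
      then have "\<not> norm z < 2 ^ j * R"
        using not_less_Least[of j "\<lambda>k. norm z < 2 ^ k * R"] unfolding k_def by simp
      then have "norm z powr - (?n + s) \<le> c j"
        unfolding c_def using R s by (intro powr_mono2') auto
      then have "ennreal (norm z powr - (?n + s)) * indicator (- ball 0 R) z
          \<le> ennreal (c j) * indicator (?B j) z"
        using k True by (auto simp: j indicator_def intro!: ennreal_leI)
      also have "\<dots> \<le> (\<Sum>j. ennreal (c j) * indicator (?B j) z)"
      proof -
        have "f j \<le> suminf f" for f :: "nat \<Rightarrow> ennreal"
          using sum_le_suminf[of f "{j}"] by simp
        then show ?thesis .
      qed
      finally show ?thesis .
    qed (auto simp: indicator_def)
  qed
  also have "\<dots> = (\<Sum>j. ennreal (c j) * emeasure lborel (?B j))"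
    by (subst nn_integral_suminf)
       (auto simp: nn_integral_cmult_indicator simp del: power_Suc
          intro!: borel_measurable_times_ennreal borel_measurable_indicator)
  also have "\<dots> = (\<Sum>j. ennreal (\<omega> * 2 powr ?n * R powr - s * (2 powr - s) ^ j))"
  proof (rule suminf_cong)
    fix j
    have "c j * (\<omega> * (2 ^ Suc j * R) ^ DIM('a)) = \<omega> * 2 powr ?n * R powr - s * (2 powr - s) ^ j"
    proof -
      have "c j = (2 powr (real j)) powr (- ?n - s) * R powr (- ?n - s)"
        using R by (simp add: c_def powr_mult powr_realpow)
      moreover have "(2 ^ Suc j * R) ^ DIM('a) = (2 powr (real j + 1)) powr ?n * R powr ?n"
        using R by (simp add: powr_realpow[symmetric] powr_mult powr_add)
      moreover have "(2 powr - s) ^ j = (2 powr - s) powr real j"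
        by (simp add: powr_realpow)
      ultimately show ?thesis
        using R by (simp add: powr_powr powr_add[symmetric] algebra_simps)
    qed
    then show "ennreal (c j) * emeasure lborel (?B j)
        = ennreal (\<omega> * 2 powr ?n * R powr - s * (2 powr - s) ^ j)"
      using R by (simp add: emeasure_ball \<omega>_def ennreal_mult'[symmetric] c_def)
  qed
  also have "\<dots> < \<infinity>"
  proof -
    have "(2::real) powr - s < 1" using s by (simp add: powr_less_one)
    then have "summable (\<lambda>j. \<omega> * 2 powr ?n * R powr - s * (2 powr - s) ^ j)"
      by (intro summable_mult summable_geometric) auto
    then show ?thesis
      by (subst suminf_ennreal2) (auto simp: \<omega>_def)
  qed
  finally show ?thesis .
qed

text \<open>Factors independent of \<open>p\<close> disappear in the root, so the estimates of the
  eigenvalue need the correct base \<open>B\<close> only.\<close>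

lemma mult_powr_root_tendsto:
  fixes A B :: real
  assumes "0 < A" "0 < B"
  shows "((\<lambda>p. (A * B powr p) powr (1 / p)) \<longlongrightarrow> B) at_top"
proof -
  have "((\<lambda>p. A powr (1 / p) * B) \<longlongrightarrow> A powr 0 * B) at_top"
    using assms by (intro tendsto_intros tendsto_divide_0[OF tendsto_const] filterlim_at_top_imp_at_infinity filterlim_ident) auto
  moreover have "\<forall>\<^sub>F p in at_top. A powr (1 / p) * B = (A * B powr p) powr (1 / p)"
    using eventually_gt_at_top[of 0]
    by eventually_elim (use assms in \<open>simp add: powr_mult powr_powr\<close>)
  ultimately show ?thesis
    using assms by (auto dest: Lim_transform_eventually)
qed

section \<open>Lower bound for the seminorm of admissible functions\<close>

text \<open>A Poincare-type inequality. For \<open>x\<close> in \<open>U \<inter> ball z r\<close>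
  and almost every \<open>y\<close> in \<open>ball z \<rho>\<close> the numerator is just
  \<open>\<bar>u x\<bar> powr p\<close>, and both points lie within \<open>r + \<rho>\<close> of
  each other, which bounds the kernel from below.\<close>

lemma gagliardo_exterior_ball_bound:
  fixes u :: "'a::euclidean_space \<Rightarrow> real"
  assumes [measurable]: "u \<in> borel_measurable borel" and "open U"
    and u0: "AE x in lborel. x \<notin> U \<longrightarrow> u x = 0"
    and disj: "ball z \<rho> \<inter> U = {}" and r: "0 < r" "0 < \<rho>" and sp: "0 < s" "0 < p"
  shows "emeasure lborel (ball z \<rho>) *
      (\<integral>\<^sup>+ x. ennreal (\<bar>u x\<bar> powr p) * indicator (U \<inter> ball z r) x \<partial>lborel)
    \<le> ennreal ((r + \<rho>) powr (real DIM('a) + s * p)) * gagliardo s p u"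
proof -
  let ?q = "real DIM('a) + s * p"
  have [measurable]: "U \<in> sets borel" "ball z r \<in> sets borel" using \<open>open U\<close> by simp_all
  have [measurable]: "(\<lambda>x. ennreal (\<bar>u x\<bar> powr p) * indicator (U \<inter> ball z r) x) \<in> borel_measurable borel"
    by measurable
  have "emeasure lborel (ball z \<rho>) *
      (\<integral>\<^sup>+ x. ennreal (\<bar>u x\<bar> powr p) * indicator (U \<inter> ball z r) x \<partial>lborel)
    = (\<integral>\<^sup>+ x. emeasure lborel (ball z \<rho>) *
        (ennreal (\<bar>u x\<bar> powr p) * indicator (U \<inter> ball z r) x) \<partial>lborel)"
    by (simp add: nn_integral_cmult)
  \<comment> \<open>The volume of the exterior ball becomes the inner integral, so that both sides
    can be compared under the double integral.\<close>
  also have "\<dots> = (\<integral>\<^sup>+ x. (\<integral>\<^sup>+ y. (ennreal (\<bar>u x\<bar> powr p) * indicator (U \<inter> ball z r) x)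
        * indicator (ball z \<rho>) y \<partial>lborel) \<partial>lborel)"
    by (subst nn_integral_cmult_indicator) (auto simp: mult.commute)
  also have "\<dots> \<le> (\<integral>\<^sup>+ x. (\<integral>\<^sup>+ y. ennreal ((r + \<rho>) powr ?q) *
        ennreal (\<bar>u x - u y\<bar> powr p / norm (x - y) powr ?q) \<partial>lborel) \<partial>lborel)"
  proof (rule nn_integral_mono, rule nn_integral_mono_AE)
    fix x
    show "AE y in lborel. ennreal (\<bar>u x\<bar> powr p) * indicator (U \<inter> ball z r) x * indicator (ball z \<rho>) y
       \<le> ennreal ((r + \<rho>) powr ?q) * ennreal (\<bar>u x - u y\<bar> powr p / norm (x - y) powr ?q)"
      using u0
    proof eventually_elim
      case (elim y)
      show ?case
      proof (cases "x \<in> U \<inter> ball z r \<and> y \<in> ball z \<rho>")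
        case True
        \<comment> \<open>\<open>x \<noteq> y\<close> matters: the kernel has a positive
          denominator, and division by zero does not interfere.\<close>
        then have "y \<notin> U" "x \<noteq> y" "u y = 0" using disj elim by auto
        have "dist x y \<le> dist z x + dist z y" by (rule dist_triangle3)
        then have "norm (x - y) \<le> r + \<rho>" using True by (simp add: dist_norm[symmetric])
        then have "norm (x - y) powr ?q \<le> (r + \<rho>) powr ?q"
          using sp by (intro powr_mono2) auto
        moreover have "0 < norm (x - y) powr ?q" using \<open>x \<noteq> y\<close> by simp
        ultimately have "\<bar>u x\<bar> powr p \<le> (r + \<rho>) powr ?q * (\<bar>u x\<bar> powr p / norm (x - y) powr ?q)"
          by (simp add: field_simps mult_left_mono)
        then show ?thesis
          using True \<open>u y = 0\<close> by (simp add: ennreal_mult[symmetric] ennreal_leI)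
      qed (auto simp: indicator_def)
    qed
  qed
  also have "\<dots> = ennreal ((r + \<rho>) powr ?q) * gagliardo s p u"
    unfolding gagliardo_def by (simp add: nn_integral_cmult)
  finally show ?thesis .
qed

text \<open>Summing the previous bound over the finite cover controls the whole integral of
  \<open>\<bar>u\<bar> powr p\<close> over \<open>U\<close>, which is \<open>1\<close>. The point is
  that \<open>A\<close> is chosen before \<open>p\<close> and \<open>u\<close>.\<close>

lemma gagliardo_normalized_ge:
  fixes U :: "'a::euclidean_space set"
  assumes U: "smooth_bounded_domain U" and s: "0 < s" and \<delta>: "0 < \<delta>" and R0: "0 < R"
    and R: "\<And>x. x \<in> closure U \<Longrightarrow> infdist x (frontier U) \<le> R"
  obtains A where "0 < A"
    "\<And>p u. 0 < p \<Longrightarrow> u \<in> sobolev_dirichlet s p U \<Longrightarrow> (LINT x:U|lborel. \<bar>u x\<bar> powr p) = 1 \<Longrightarrow>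
       A * ((R + 2 * \<delta>) powr - s) powr p \<le> enn2real (gagliardo s p u)"
proof -
  let ?n = "real DIM('a)"
  have "open U" using U by (simp add: smooth_bounded_domain_def)
  then have [measurable]: "U \<in> sets borel" by simp
  obtain Z \<rho> where Z: "finite Z" and \<rho>: "0 < \<rho>" "\<rho> \<le> \<delta>"
    and cover: "U \<subseteq> (\<Union>z\<in>Z. ball z (R + \<delta>))"
    and disj: "\<And>z. z \<in> Z \<Longrightarrow> ball z \<rho> \<inter> U = {}"
    using exterior_ball_cover[OF U \<delta> R] by blast
  have "Z \<noteq> {}" using cover U by (auto simp: smooth_bounded_domain_def)
  then have card: "0 < card Z" using Z by (simp add: card_gt_0_iff)
  define b where "b = unit_ball_vol ?n * \<rho> ^ DIM('a)"
  have b: "0 < b" using \<rho> by (simp add: b_def)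
  \<comment> \<open>Volume of an exterior ball, divided by the number of balls, times the part of
    \<open>(R + 2 * \<delta>) powr - (n + s * p)\<close> that does not depend on
    \<open>p\<close>.\<close>
  define A where "A = b / card Z * (R + 2 * \<delta>) powr - ?n"
  have "0 < A" using b card R0 \<delta> by (simp add: A_def)
  moreover have "A * ((R + 2 * \<delta>) powr - s) powr p \<le> enn2real (gagliardo s p u)"
    if p: "0 < p" and u: "u \<in> sobolev_dirichlet s p U"
      and norm: "(LINT x:U|lborel. \<bar>u x\<bar> powr p) = 1" for p u
  proof -
    have [measurable]: "u \<in> borel_measurable borel"
      and fin: "gagliardo s p u < \<infinity>" and u0: "AE x in lborel. x \<notin> U \<longrightarrow> u x = 0"
      using u by (auto simp: sobolev_dirichlet_def sobolev_def)
    define C where "C = (R + 2 * \<delta>) powr (?n + s * p)"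
    have C: "0 < C" using R0 \<delta> by (simp add: C_def)
    define G where "G = enn2real (gagliardo s p u)"
    have G: "gagliardo s p u = ennreal G" "0 \<le> G"
      using fin by (simp_all add: G_def)
    \<comment> \<open>A nonintegrable function would have integral \<open>0\<close>, so the
      normalization itself yields integrability.\<close>
    have "integrable lborel (\<lambda>x. indicator U x *\<^sub>R \<bar>u x\<bar> powr p)"
      using norm unfolding set_lebesgue_integral_def
      by (metis not_integrable_integral_eq zero_neq_one)
    then have one: "(\<integral>\<^sup>+ x. ennreal (indicator U x *\<^sub>R \<bar>u x\<bar> powr p) \<partial>lborel) = 1"
      using norm unfolding set_lebesgue_integral_def
      by (subst nn_integral_eq_integral) (auto simp: indicator_def)
    have "ennreal b = ennreal b * (\<integral>\<^sup>+ x. ennreal (indicator U x *\<^sub>R \<bar>u x\<bar> powr p) \<partial>lborel)"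
      unfolding one by simp
    also have "\<dots> \<le> ennreal b * (\<integral>\<^sup>+ x. (\<Sum>z\<in>Z. ennreal (\<bar>u x\<bar> powr p) * indicator (U \<inter> ball z (R + \<delta>)) x) \<partial>lborel)"
    proof (intro mult_left_mono nn_integral_mono)
      fix x
      show "ennreal (indicator U x *\<^sub>R \<bar>u x\<bar> powr p)
        \<le> (\<Sum>z\<in>Z. ennreal (\<bar>u x\<bar> powr p) * indicator (U \<inter> ball z (R + \<delta>)) x)"
      proof (cases "x \<in> U")
        case True
        then obtain z where z: "z \<in> Z" "x \<in> ball z (R + \<delta>)" using cover by blast
        have "ennreal (indicator U x *\<^sub>R \<bar>u x\<bar> powr p)
            = ennreal (\<bar>u x\<bar> powr p) * indicator (U \<inter> ball z (R + \<delta>)) x"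
          using True z by simp
        also have "\<dots> \<le> (\<Sum>z\<in>Z. ennreal (\<bar>u x\<bar> powr p) * indicator (U \<inter> ball z (R + \<delta>)) x)"
          by (rule member_le_sum[OF z(1)]) (use Z in auto)
        finally show ?thesis .
      qed simp
    qed simp
    also have "\<dots> = (\<Sum>z\<in>Z. emeasure lborel (ball z \<rho>) *
        (\<integral>\<^sup>+ x. ennreal (\<bar>u x\<bar> powr p) * indicator (U \<inter> ball z (R + \<delta>)) x \<partial>lborel))"
    proof -
      have "(\<lambda>x. ennreal (\<bar>u x\<bar> powr p) * indicator (U \<inter> ball z (R + \<delta>)) x) \<in> borel_measurable borel" for z
      proof -
        have [measurable]: "ball z (R + \<delta>) \<in> sets borel" by simp
        show ?thesis by measurable
      qed
      then show ?thesis
        using \<rho> by (simp add: nn_integral_sum emeasure_ball b_def sum_distrib_left)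
    qed
    also have "\<dots> \<le> (\<Sum>z\<in>Z. ennreal (C * G))"
    proof (rule sum_mono)
      fix z assume "z \<in> Z"
      have "emeasure lborel (ball z \<rho>) *
        (\<integral>\<^sup>+ x. ennreal (\<bar>u x\<bar> powr p) * indicator (U \<inter> ball z (R + \<delta>)) x \<partial>lborel)
        \<le> ennreal ((R + \<delta> + \<rho>) powr (?n + s * p)) * gagliardo s p u"
        using \<open>open U\<close> u0 disj[OF \<open>z \<in> Z\<close>] \<rho> R0 \<delta> s p
        by (intro gagliardo_exterior_ball_bound) auto
      \<comment> \<open>Here \<open>\<rho> \<le> \<delta>\<close> turns
        \<open>R + \<delta> + \<rho>\<close> into \<open>R + 2 * \<delta>\<close>.\<close>
      also have "\<dots> \<le> ennreal C * gagliardo s p u"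
        unfolding C_def using \<rho> R0 \<delta> s p
        by (intro mult_right_mono ennreal_leI powr_mono2) auto
      finally show "emeasure lborel (ball z \<rho>) *
        (\<integral>\<^sup>+ x. ennreal (\<bar>u x\<bar> powr p) * indicator (U \<inter> ball z (R + \<delta>)) x \<partial>lborel)
        \<le> ennreal (C * G)" using G C by (simp add: ennreal_mult)
    qed
    also have "\<dots> = ennreal (card Z * (C * G))"
      using C G by (simp add: ennreal_mult ennreal_of_nat_eq_real_of_nat)
    finally have "b \<le> card Z * (C * G)" using C G by (simp add: ennreal_le_iff)
    then have "b / card Z / C \<le> G"
      using C card by (simp add: field_simps)
    moreover have "b / card Z / C = A * ((R + 2 * \<delta>) powr - s) powr p"
    proof -
      have "((R + 2 * \<delta>) powr - s) powr p = (R + 2 * \<delta>) powr - (s * p)"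
        by (simp add: powr_powr)
      then show ?thesis
        by (simp add: A_def C_def powr_minus powr_add divide_inverse)
    qed
    ultimately show ?thesis by (simp add: G_def)
  qed
  ultimately show thesis by (rule that)
qed

section \<open>Upper bound by the normalized cone\<close>

lemma gagliardo_scale:
  fixes u :: "'a::euclidean_space \<Rightarrow> real"
  assumes [measurable]: "u \<in> borel_measurable borel"
  shows "gagliardo s p (\<lambda>x. c * u x) = ennreal (\<bar>c\<bar> powr p) * gagliardo s p u"
proof -
  have "ennreal (\<bar>c * u x - c * u y\<bar> powr p / norm (x - y) powr q)
      = ennreal (\<bar>c\<bar> powr p) * ennreal (\<bar>u x - u y\<bar> powr p / norm (x - y) powr q)" for x y q
    by (simp add: right_diff_distrib[symmetric] abs_mult powr_mult ennreal_mult[symmetric])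
  then show ?thesis
    unfolding gagliardo_def by (simp add: nn_integral_cmult)
qed

text \<open>To be read with \<open>a\<close> a difference of values of the cone and \<open>t\<close>
  the distance of the points. For \<open>t < R\<close> the bound \<open>a \<le> t\<close> leaves
  \<open>t\<close> with the nonnegative exponent \<open>(1 - s) * p - n\<close>. Otherwise
  \<open>a \<le> R\<close> is used, and of the decay only \<open>t powr - (n + s)\<close> is kept,
  enough for integrability at infinity. All dependence on \<open>p\<close> sits in the first
  factor.\<close>

lemma truncated_difference_quotient_le:
  fixes a t R s p n :: real
  assumes a: "0 \<le> a" "a \<le> R" "a \<le> t" and R: "0 < R" and s: "0 < s" and p: "1 \<le> p" "n \<le> (1 - s) * p"
  shows "a powr p / t powr (n + s * p) \<le> (R powr (1 - s)) powr p *
    (if t < R then R powr - n else R powr s * t powr - (n + s))"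
\<comment> \<open>On the diagonal also \<open>a = 0\<close>, and the left side is \<open>0\<close>
  by the conventions for \<open>powr\<close> and division.\<close>
proof (cases "t = 0")
  case False
  then have t: "0 < t" using a by simp
  show ?thesis
  proof (cases "t < R")
    case True
    have "a powr p / t powr (n + s * p) \<le> t powr p / t powr (n + s * p)"
      using a p by (intro divide_right_mono powr_mono2) auto
    also have "\<dots> = t powr ((1 - s) * p - n)"
      by (simp add: powr_diff[symmetric] algebra_simps)
    also have "\<dots> \<le> R powr ((1 - s) * p - n)"
      using True t p by (intro powr_mono2) auto
    also have "\<dots> = (R powr (1 - s)) powr p * R powr - n"
      using R by (simp add: powr_powr powr_add[symmetric])
    finally show ?thesis using True by simp
  next
    case False
    have "a powr p / t powr (n + s * p) \<le> R powr p / t powr (n + s * p)"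
      using a p by (intro divide_right_mono powr_mono2) auto
    also have "\<dots> = R powr p * (t powr - (n + s) * t powr - (s * (p - 1)))"
      by (simp add: powr_add[symmetric] powr_minus_divide[symmetric] divide_inverse powr_minus[symmetric] algebra_simps)
    also have "\<dots> \<le> R powr p * (t powr - (n + s) * R powr - (s * (p - 1)))"
      using False R s p by (intro mult_left_mono powr_mono2') auto
    also have "\<dots> = (R powr (1 - s)) powr p * (R powr s * t powr - (n + s))"
      using R by (simp add: powr_powr powr_add[symmetric] algebra_simps)
    finally show ?thesis using False by simp
  qed
qed (use a in auto)

text \<open>The integrand vanishes unless \<open>x\<close> or \<open>y\<close> lies in the ball, and
  it is dominated by \<open>(R powr (1 - s)) powr p\<close> times an integrable kernel
  \<open>k\<close> of \<open>x - y\<close> that does not depend on \<open>p\<close>. Translation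
  invariance bounds each of the two cases by the integral of \<open>k\<close> times the volume of
  the ball.\<close>

lemma gagliardo_cone_le:
  fixes x0 :: "'a::euclidean_space"
  assumes R: "0 < R" and s: "0 < s"
  obtains C where "0 < C"
    "\<And>p. 1 \<le> p \<Longrightarrow> real DIM('a) \<le> (1 - s) * p \<Longrightarrow>
      gagliardo s p (\<lambda>x. max 0 (R - norm (x - x0))) \<le> ennreal (C * (R powr (1 - s)) powr p)"
proof -
  let ?n = "real DIM('a)"
  let ?B = "ball x0 R"
  define u where "u = (\<lambda>x. max 0 (R - norm (x - x0)))"
  define k where "k z = (if norm z < R then R powr - ?n else R powr s * norm z powr - (?n + s))"
    for z :: 'a
  have [measurable]: "k \<in> borel_measurable borel" unfolding k_def by measurable
  have [measurable]: "?B \<in> sets borel" "ball (0::'a) R \<in> sets borel" "- ball (0::'a) R \<in> sets borel" by simp_all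
  have [measurable]: "(\<lambda>z. ennreal (norm z powr - (?n + s)) * indicator (- ball 0 R) (z::'a)) \<in> borel_measurable borel"
    by measurable
  have "(\<integral>\<^sup>+ z. ennreal (k z) \<partial>lborel) \<le> (\<integral>\<^sup>+ z. ennreal (R powr - ?n) * indicator (ball 0 R) (z::'a)
      + ennreal (R powr s) * (ennreal (norm z powr - (?n + s)) * indicator (- ball 0 R) z) \<partial>lborel)"
    by (intro nn_integral_mono) (auto simp: k_def ennreal_mult indicator_def)
  also have "\<dots> = ennreal (R powr - ?n) * emeasure lborel (ball (0::'a) R) + ennreal (R powr s) *
      (\<integral>\<^sup>+ z. ennreal (norm z powr - (?n + s)) * indicator (- ball 0 R) (z::'a) \<partial>lborel)"
    by (subst nn_integral_add) (simp_all add: nn_integral_cmult nn_integral_cmult_indicator)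
  also have "\<dots> < \<infinity>"
    using nn_integral_power_tail_finite[where 'a = 'a, OF R s] emeasure_lborel_ball_finite[of "0::'a" R]
    by (auto simp: ennreal_mult_less_top)
  finally obtain \<kappa> where \<kappa>: "(\<integral>\<^sup>+ z. ennreal (k z) \<partial>lborel) = ennreal \<kappa>" "0 \<le> \<kappa>"
    by (auto simp: less_top_ennreal)
  have ksym: "k (x - y) = k (y - x)" for x y by (simp add: k_def norm_minus_commute)
  have trans: "(\<integral>\<^sup>+ y. ennreal (k (y - x)) \<partial>lborel) = ennreal \<kappa>" for x
    using nn_integral_lborel_translate[of "\<lambda>z. ennreal (k z)" x] \<kappa> by simp
  define b where "b = unit_ball_vol ?n * R ^ DIM('a)"
  have b: "emeasure lborel ?B = ennreal b" "0 < b"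
    using R by (simp_all add: b_def emeasure_ball)
  have trans': "(\<integral>\<^sup>+ x. ennreal (k (y - x)) \<partial>lborel) = ennreal \<kappa>" for y
    using trans[of y] by (simp only: ksym[of y])
  have ball_int: "(\<integral>\<^sup>+ x. indicator ?B x * ennreal \<kappa> \<partial>lborel) = ennreal (\<kappa> * b)"
    using b \<kappa> by (simp add: mult.commute[of _ "ennreal \<kappa>"] nn_integral_cmult_indicator ennreal_mult)
  have sym: "(\<integral>\<^sup>+ x. \<integral>\<^sup>+ y. indicator ?B x * ennreal (k (y - x)) \<partial>lborel \<partial>lborel) = ennreal (\<kappa> * b)"
    by (simp add: nn_integral_cmult trans ball_int)
  \<comment> \<open>With the indicator on \<open>y\<close>, the outer integral has to be carried out
    first; Tonelli and the symmetry of \<open>k\<close> reduce this to the previous case.\<close>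
  have swap: "(\<integral>\<^sup>+ x. \<integral>\<^sup>+ y. indicator ?B y * ennreal (k (y - x)) \<partial>lborel \<partial>lborel) = ennreal (\<kappa> * b)"
  proof -
    have "(\<integral>\<^sup>+ x. \<integral>\<^sup>+ y. indicator ?B y * ennreal (k (y - x)) \<partial>lborel \<partial>lborel)
        = (\<integral>\<^sup>+ y. \<integral>\<^sup>+ x. indicator ?B y * ennreal (k (y - x)) \<partial>lborel \<partial>lborel)"
      by (rule lborel_pair.Fubini') measurable
    also have "\<dots> = ennreal (\<kappa> * b)"
      by (simp add: nn_integral_cmult trans' ball_int)
    finally show ?thesis .
  qed
  \<comment> \<open>The summand \<open>1\<close> makes the constant positive without a proof that
    \<open>\<kappa>\<close> is.\<close>
  have "gagliardo s p u \<le> ennreal ((2 * (\<kappa> * b) + 1) * (R powr (1 - s)) powr p)"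
    if p: "1 \<le> p" "?n \<le> (1 - s) * p" for p
  proof -
    let ?c = "ennreal ((R powr (1 - s)) powr p)"
    have "gagliardo s p u \<le> (\<integral>\<^sup>+ x. \<integral>\<^sup>+ y. ?c *
        (indicator ?B x * ennreal (k (y - x)) + indicator ?B y * ennreal (k (y - x))) \<partial>lborel \<partial>lborel)"
      unfolding gagliardo_def
    proof (intro nn_integral_mono)
      fix x y
      have "\<bar>u x - u y\<bar> \<le> R" "\<bar>u x - u y\<bar> \<le> norm (x - y)"
      proof -
        have "norm (x - x0) - norm (y - x0) \<le> norm (x - y)"
          using norm_triangle_ineq2[of "x - x0" "y - x0"] by simp
        moreover have "norm (y - x0) - norm (x - x0) \<le> norm (x - y)"
          using norm_triangle_ineq2[of "y - x0" "x - x0"] by (simp add: norm_minus_commute)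
        moreover have "0 \<le> norm (x - x0)" "0 \<le> norm (y - x0)" by simp_all
        ultimately show "\<bar>u x - u y\<bar> \<le> R" "\<bar>u x - u y\<bar> \<le> norm (x - y)"
          unfolding u_def using R by linarith+
      qed
      then have Q: "\<bar>u x - u y\<bar> powr p / norm (x - y) powr (?n + s * p)
          \<le> (R powr (1 - s)) powr p * k (x - y)"
        unfolding k_def using R s p by (intro truncated_difference_quotient_le) auto
      show "ennreal (\<bar>u x - u y\<bar> powr p / norm (x - y) powr (?n + s * p))
        \<le> ?c * (indicator ?B x * ennreal (k (y - x)) + indicator ?B y * ennreal (k (y - x)))"
      proof (cases "x \<in> ?B \<or> y \<in> ?B")
        case True
        have "ennreal (\<bar>u x - u y\<bar> powr p / norm (x - y) powr (?n + s * p)) \<le> ?c * ennreal (k (y - x))"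
          using Q unfolding ksym[of x y] by (simp add: ennreal_mult'[symmetric] ennreal_leI)
        also have "\<dots> \<le> ?c * (indicator ?B x * ennreal (k (y - x)) + indicator ?B y * ennreal (k (y - x)))"
          using True by (intro mult_left_mono) (auto simp: indicator_def)
        finally show ?thesis .
      next
        case False
        then have "u x - u y = 0" by (simp add: u_def dist_norm norm_minus_commute)
        then show ?thesis by simp
      qed
    qed
    also have "\<dots> = (\<integral>\<^sup>+ x. ?c * ((\<integral>\<^sup>+ y. indicator ?B x * ennreal (k (y - x)) \<partial>lborel)
        + (\<integral>\<^sup>+ y. indicator ?B y * ennreal (k (y - x)) \<partial>lborel)) \<partial>lborel)"
    proof (rule nn_integral_cong)
      fix x
      have 1: "(\<lambda>y. indicator ?B x * ennreal (k (y - x))) \<in> borel_measurable lborel"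
        by measurable
      have 2: "(\<lambda>y. indicator ?B y * ennreal (k (y - x))) \<in> borel_measurable lborel"
        by measurable
      show "(\<integral>\<^sup>+ y. ?c *
          (indicator ?B x * ennreal (k (y - x)) + indicator ?B y * ennreal (k (y - x))) \<partial>lborel)
        = ?c * ((\<integral>\<^sup>+ y. indicator ?B x * ennreal (k (y - x)) \<partial>lborel)
        + (\<integral>\<^sup>+ y. indicator ?B y * ennreal (k (y - x)) \<partial>lborel))"
        using nn_integral_add[OF 1 2]
          nn_integral_cmult[OF borel_measurable_add[OF 1 2], of ?c] by simp
    qed
    also have "\<dots> = ?c * (ennreal (\<kappa> * b) + ennreal (\<kappa> * b))"
    proof -
      have 1: "(\<lambda>x. \<integral>\<^sup>+ y. indicator ?B x * ennreal (k (y - x)) \<partial>lborel) \<in> borel_measurable lborel"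
        by measurable
      have 2: "(\<lambda>x. \<integral>\<^sup>+ y. indicator ?B y * ennreal (k (y - x)) \<partial>lborel) \<in> borel_measurable lborel"
        by measurable
      show ?thesis
        using nn_integral_add[OF 1 2]
          nn_integral_cmult[OF borel_measurable_add[OF 1 2], of ?c] by (simp only: sym swap)
    qed
    also have "\<dots> = ennreal ((R powr (1 - s)) powr p * (2 * (\<kappa> * b)))"
      using \<kappa> b by (simp add: ennreal_plus[symmetric] ennreal_mult[symmetric] del: ennreal_plus)
    also have "\<dots> \<le> ennreal ((2 * (\<kappa> * b) + 1) * (R powr (1 - s)) powr p)"
      by (intro ennreal_leI) (simp add: algebra_simps)
    finally show ?thesis .
  qed
  moreover have "0 < 2 * (\<kappa> * b) + 1" using \<kappa> b by (simp add: add_nonneg_pos)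
  ultimately show thesis unfolding u_def by (intro that) auto
qed

text \<open>The cone is at least \<open>R - \<delta>\<close> on \<open>ball x0 \<delta>\<close>,
  which bounds its \<open>p\<close>-norm from below; after normalization it is a competitor. Its
  existence is exported as well, since the infimum defining the eigenvalue must range over a
  nonempty set.\<close>

lemma eigenvalue_dirichlet_le:
  fixes U :: "'a::euclidean_space set"
  assumes U: "open U" and R: "0 < R" "ball x0 R \<subseteq> U" and s: "0 < s" and \<delta>: "0 < \<delta>" "\<delta> < R"
  obtains A where "0 < A"
    "\<And>p. 1 \<le> p \<Longrightarrow> real DIM('a) \<le> (1 - s) * p \<Longrightarrow>
      eigenvalue_dirichlet s p U \<le> A * (R powr (1 - s) / (R - \<delta>)) powr p \<and>
      (\<exists>u\<in>sobolev_dirichlet s p U. (LINT x:U|lborel. \<bar>u x\<bar> powr p) = 1)"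
proof -
  let ?n = "real DIM('a)"
  let ?B = "ball x0 R"
  define u where "u = (\<lambda>x. max 0 (R - norm (x - x0)))"
  have [measurable]: "u \<in> borel_measurable borel" unfolding u_def by measurable
  have [measurable]: "U \<in> sets borel" using U by simp
  have u: "0 \<le> u x" "u x \<le> R" "x \<notin> ?B \<Longrightarrow> u x = 0" for x
    using R by (auto simp: u_def dist_norm norm_minus_commute)
  obtain C where C: "0 < C"
    and gag: "\<And>p. 1 \<le> p \<Longrightarrow> ?n \<le> (1 - s) * p \<Longrightarrow> gagliardo s p u \<le> ennreal (C * (R powr (1 - s)) powr p)"
    using gagliardo_cone_le[OF R(1) s, of x0] unfolding u_def by blast
  define b where "b = measure lborel (ball x0 \<delta>)"
  have b: "0 < b" using \<delta> by (simp add: b_def content_ball_pos)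
  have "0 < C / b" using C b by simp
  moreover have "eigenvalue_dirichlet s p U \<le> C / b * (R powr (1 - s) / (R - \<delta>)) powr p \<and>
      (\<exists>u\<in>sobolev_dirichlet s p U. (LINT x:U|lborel. \<bar>u x\<bar> powr p) = 1)"
    if p: "1 \<le> p" "?n \<le> (1 - s) * p" for p
  proof -
    have int: "integrable lborel (\<lambda>x. u x powr p)"
    proof (rule Bochner_Integration.integrable_bound)
      show "integrable lborel (\<lambda>x. R powr p * indicator ?B x)"
        using emeasure_lborel_ball_finite[of x0 R] by (auto intro!: integrable_mult_right integrable_real_indicator)
      show "AE x in lborel. norm (u x powr p) \<le> norm (R powr p * indicator ?B x)"
        using u p by (intro AE_I2) (auto simp: indicator_def intro!: powr_mono2)
    qed measurable
    define I where "I = (LINT x|lborel. u x powr p)"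
    have "(R - \<delta>) powr p * b = (LINT x|lborel. (R - \<delta>) powr p * indicator (ball x0 \<delta>) x)"
      by (simp add: b_def)
    also have "\<dots> \<le> I"
      unfolding I_def
    proof (rule integral_mono[OF _ int])
      show "integrable lborel (\<lambda>x. (R - \<delta>) powr p * indicator (ball x0 \<delta>) x)"
        using emeasure_lborel_ball_finite[of x0 \<delta>] by (auto intro!: integrable_mult_right integrable_real_indicator)
      show "(R - \<delta>) powr p * indicator (ball x0 \<delta>) x \<le> u x powr p" for x
        using \<delta> p by (auto simp: indicator_def u_def dist_norm norm_minus_commute intro!: powr_mono2)
    qed
    finally have I: "(R - \<delta>) powr p * b \<le> I" .
    have I_pos: "0 < I" using I b \<delta> by (smt (verit) mult_pos_pos powr_gt_zero)
    \<comment> \<open>The factor that normalizes the integral of the \<open>p\<close>-th power to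
      \<open>1\<close>.\<close>
    define c where "c = I powr - (1 / p)"
    have "c powr p = I powr - 1" using p by (simp add: c_def powr_powr)
    then have c: "0 < c" "c powr p = 1 / I"
      using I_pos by (simp_all add: c_def powr_minus_divide)
    define v where "v = (\<lambda>x. c * u x)"
    have [measurable]: "v \<in> borel_measurable borel" unfolding v_def by measurable
    have vp: "\<bar>v x\<bar> powr p = u x powr p / I" for x
      using u[of x] c by (simp add: v_def abs_mult powr_mult)
    have gv: "gagliardo s p v = ennreal (1 / I) * gagliardo s p u"
      unfolding v_def using c by (subst gagliardo_scale) auto
    also have "\<dots> \<le> ennreal (1 / I) * ennreal (C * (R powr (1 - s)) powr p)"
      by (intro mult_left_mono gag p) simp
    also have "\<dots> = ennreal (C * (R powr (1 - s)) powr p / I)"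
      using I_pos C by (simp add: ennreal_mult[symmetric])
    finally have gv_le: "gagliardo s p v \<le> ennreal (C * (R powr (1 - s)) powr p / I)" .
    have "(\<integral>\<^sup>+ x. ennreal (\<bar>v x\<bar> powr p) \<partial>lborel) < \<infinity>"
      unfolding vp using int I_pos by (subst nn_integral_eq_integral) auto
    moreover have "gagliardo s p v < \<infinity>" using gv_le by (rule le_less_trans) simp
    moreover have v0: "v x = 0" if "x \<notin> U" for x
    proof -
      have "x \<notin> ?B" using R that by blast
      then show ?thesis using u(3)[of x] by (simp add: v_def)
    qed
    ultimately have vS: "v \<in> sobolev_dirichlet s p U"
      by (auto simp: sobolev_dirichlet_def sobolev_def)
    have "indicator U x *\<^sub>R \<bar>v x\<bar> powr p = u x powr p / I" for x
      using v0[of x] vp[of x] by (cases "x \<in> U") auto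
    then have vI: "(LINT x:U|lborel. \<bar>v x\<bar> powr p) = 1"
      using I_pos by (simp add: set_lebesgue_integral_def I_def)
    have "eigenvalue_dirichlet s p U \<le> enn2real (gagliardo s p v)"
      unfolding eigenvalue_dirichlet_def
      using vS vI by (intro cInf_lower bdd_belowI[of _ 0]) auto
    also have "\<dots> \<le> C * (R powr (1 - s)) powr p / I"
      using gv_le C I_pos by (intro enn2real_leI) auto
    also have "\<dots> \<le> C * (R powr (1 - s)) powr p / ((R - \<delta>) powr p * b)"
      using I I_pos C b \<delta> by (intro divide_left_mono) auto
    also have "\<dots> = C / b * (R powr (1 - s) / (R - \<delta>)) powr p"
      using \<delta> by (simp add: powr_divide)
    finally show ?thesis using vS vI by blast
  qed
  ultimately show thesis by (rule that)
qed

section \<open>Limit of the roots and conclusion\<close>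

text \<open>Given a level \<open>a\<close> on either side of \<open>R powr - s\<close>, first
  \<open>\<delta>\<close> is fixed so that the base of the corresponding bound lies beyond
  \<open>a\<close>, and only then \<open>p\<close> tends to infinity.\<close>

lemma eigenvalue_dirichlet_root_tendsto:
  fixes U :: "'a::euclidean_space set"
  assumes U: "smooth_bounded_domain U" and s: "0 < s" "s < 1"
    and R: "0 < R" "ball x0 R \<subseteq> U"
    and R_max: "\<And>x. x \<in> closure U \<Longrightarrow> infdist x (frontier U) \<le> R"
  shows "((\<lambda>p. eigenvalue_dirichlet s p U powr (1 / p)) \<longlongrightarrow> R powr - s) at_top"
proof (rule order_tendstoI)
  let ?n = "real DIM('a)"
  have "open U" using U by (simp add: smooth_bounded_domain_def)
  \<comment> \<open>The range of \<open>p\<close> in which the cone estimate holds;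
    \<open>s < 1\<close> makes it a neighbourhood of infinity.\<close>
  have large: "\<forall>\<^sub>F p in at_top. 1 \<le> p \<and> ?n \<le> (1 - s) * p"
    using eventually_ge_at_top[of 1] eventually_ge_at_top[of "?n / (1 - s)"]
    by eventually_elim (use s in \<open>simp add: field_simps\<close>)
  have small: "\<forall>\<^sub>F \<delta> in at_right 0. 0 < \<delta> \<and> \<delta> < R"
    using R by (auto simp: eventually_at_right)
  {
    fix a assume a: "a < R powr - s"
    have "((\<lambda>\<delta>. (R + 2 * \<delta>) powr - s) \<longlongrightarrow> (R + 2 * 0) powr - s) (at_right 0)"
      using R by (intro tendsto_intros) auto
    then have ev: "\<forall>\<^sub>F \<delta> in at_right 0. a < (R + 2 * \<delta>) powr - s"
      using a by (intro order_tendstoD) auto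
    obtain \<delta> where \<delta>: "0 < \<delta>" "a < (R + 2 * \<delta>) powr - s"
      using eventually_happens'[OF trivial_limit_at_right_real eventually_conj[OF small ev]] by auto
    obtain A where A: "0 < A"
      "\<And>p u. 0 < p \<Longrightarrow> u \<in> sobolev_dirichlet s p U \<Longrightarrow> (LINT x:U|lborel. \<bar>u x\<bar> powr p) = 1 \<Longrightarrow>
       A * ((R + 2 * \<delta>) powr - s) powr p \<le> enn2real (gagliardo s p u)"
      using gagliardo_normalized_ge[OF U s(1) \<delta>(1) R(1) R_max] by blast
    \<comment> \<open>Only the existence of an admissible function is taken from this, for
      \<open>cInf_greatest\<close>; \<open>R / 2\<close> is an arbitrary choice between
      \<open>0\<close> and \<open>R\<close>.\<close>
    obtain A' where A': "0 < A'"
      "\<And>p. 1 \<le> p \<Longrightarrow> ?n \<le> (1 - s) * p \<Longrightarrow>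
        eigenvalue_dirichlet s p U \<le> A' * (R powr (1 - s) / (R - R / 2)) powr p \<and>
        (\<exists>u\<in>sobolev_dirichlet s p U. (LINT x:U|lborel. \<bar>u x\<bar> powr p) = 1)"
      using eigenvalue_dirichlet_le[OF \<open>open U\<close> R s(1), of "R / 2"] R(1) by auto
    have "((\<lambda>p. (A * ((R + 2 * \<delta>) powr - s) powr p) powr (1 / p)) \<longlongrightarrow> (R + 2 * \<delta>) powr - s) at_top"
      using A(1) R \<delta> by (intro mult_powr_root_tendsto) auto
    then have "\<forall>\<^sub>F p in at_top. a < (A * ((R + 2 * \<delta>) powr - s) powr p) powr (1 / p)"
      using \<delta> by (intro order_tendstoD) auto
    then show "\<forall>\<^sub>F p in at_top. a < eigenvalue_dirichlet s p U powr (1 / p)"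
      using large
    proof eventually_elim
      case (elim p)
      have "A * ((R + 2 * \<delta>) powr - s) powr p \<le> eigenvalue_dirichlet s p U"
        unfolding eigenvalue_dirichlet_def
        using A'(2)[of p] A(2)[of p] elim by (intro cInf_greatest) auto
      then have "(A * ((R + 2 * \<delta>) powr - s) powr p) powr (1 / p) \<le> eigenvalue_dirichlet s p U powr (1 / p)"
        using A(1) elim by (intro powr_mono2) auto
      then show ?case using elim by simp
    qed
  next
    fix a assume a: "R powr - s < a"
    have "((\<lambda>\<delta>. R powr (1 - s) / (R - \<delta>)) \<longlongrightarrow> R powr (1 - s) / (R - 0)) (at_right 0)"
      using R by (intro tendsto_intros) auto
    moreover have "R powr (1 - s) / (R - 0) = R powr - s"
      using R by (simp add: powr_diff powr_minus_divide)
    ultimately have ev: "\<forall>\<^sub>F \<delta> in at_right 0. R powr (1 - s) / (R - \<delta>) < a"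
      using a by (intro order_tendstoD) auto
    obtain \<delta> where \<delta>: "0 < \<delta>" "\<delta> < R" "R powr (1 - s) / (R - \<delta>) < a"
      using eventually_happens'[OF trivial_limit_at_right_real eventually_conj[OF small ev]] by auto
    obtain A where A: "0 < A"
      "\<And>p. 1 \<le> p \<Longrightarrow> ?n \<le> (1 - s) * p \<Longrightarrow>
        eigenvalue_dirichlet s p U \<le> A * (R powr (1 - s) / (R - \<delta>)) powr p \<and>
        (\<exists>u\<in>sobolev_dirichlet s p U. (LINT x:U|lborel. \<bar>u x\<bar> powr p) = 1)"
      using eigenvalue_dirichlet_le[OF \<open>open U\<close> R s(1) \<delta>(1,2)] by blast
    have "((\<lambda>p. (A * (R powr (1 - s) / (R - \<delta>)) powr p) powr (1 / p)) \<longlongrightarrow> R powr (1 - s) / (R - \<delta>)) at_top"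
      using A(1) R \<delta> by (intro mult_powr_root_tendsto) auto
    then have "\<forall>\<^sub>F p in at_top. (A * (R powr (1 - s) / (R - \<delta>)) powr p) powr (1 / p) < a"
      using \<delta> by (intro order_tendstoD) auto
    then show "\<forall>\<^sub>F p in at_top. eigenvalue_dirichlet s p U powr (1 / p) < a"
      using large
    proof eventually_elim
      case (elim p)
      \<comment> \<open>Nonnegativity is required because \<open>powr\<close> is monotone in its
        base only there.\<close>
      have "0 \<le> eigenvalue_dirichlet s p U"
        unfolding eigenvalue_dirichlet_def
        using A(2)[of p] elim by (intro cInf_greatest) auto
      then have "eigenvalue_dirichlet s p U powr (1 / p) \<le> (A * (R powr (1 - s) / (R - \<delta>)) powr p) powr (1 / p)"
        using A(2)[of p] elim by (intro powr_mono2) auto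
      then show ?case using elim by simp
    qed
  }
qed

theorem theorem1p1:
  fixes U :: "'a::euclidean_space set" and s :: real
  assumes "smooth_bounded_domain U" and "0 < s" and "s < 1"
  shows "1 / Lambda_dirichlet s U =
    (SUP \<mu> \<in> borel_probs (closure U).
       transport_cost_to s (closure U) \<mu> (borel_probs (frontier U)))"
proof -
  obtain x0 where x0: "x0 \<in> U" "0 < infdist x0 (frontier U)"
    "ball x0 (infdist x0 (frontier U)) \<subseteq> U"
    "\<And>x. x \<in> closure U \<Longrightarrow> infdist x (frontier U) \<le> infdist x0 (frontier U)"
    using deepest_point[OF assms(1)] by blast
  \<comment> \<open>\<open>Lim\<close> is a definite description, so its value is accessible only
    through the convergence just proved and uniqueness of limits.\<close>
  have "Lambda_dirichlet s U = infdist x0 (frontier U) powr - s"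
    unfolding Lambda_dirichlet_def
    by (rule tendsto_Lim[OF _ eigenvalue_dirichlet_root_tendsto[OF assms x0(2-4)]]) auto
  moreover have "(SUP \<mu> \<in> borel_probs (closure U).
       transport_cost_to s (closure U) \<mu> (borel_probs (frontier U))) = infdist x0 (frontier U) powr s"
    using assms x0 smooth_bounded_domain_frontier_nonempty[OF assms(1)] closure_subset[of U]
    by (intro SUP_transport_cost_to) (auto simp: smooth_bounded_domain_def frontier_def)
  ultimately show ?thesis by (simp add: powr_minus divide_inverse)
qed

end
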